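(* Let $R$ be a commutative ring and let $M$ be a finitely generated $R$-module. For any proper submodule $N$ of $M$, the radical $\sqrt{N}$ of $N$ is the smallest semiprime submodule of $M$ that contains $N$. In particular, a proper submodule $N$ of $M$ is semiprime if and only if it is a radical submodule, i.e. $\sqrt{N}=N$.
   Context: All rings are unital, associative and commutative, and all modules are unital. For a submodule $N$ of an $R$-module $M$ and $m\in M$, write $(N:m)=\{r\in R \mid rm\in N\}$, an ideal of $R$. For an ideal $I$ of $R$, $IM$ denotes the submodule of $M$ generated by all $am'$ with $a\in I$, $m'\in M$. A submodule $N$ of $M$ is called semiprime if for all $m\in M$, $m\in (N:m)M$ implies $m\in N$. (In particular, $M$ itself is a semiprime submodule of $M$.) A submodule $P$ of $M$ is called prime if for all $r\in R$ and $m\in M$, $rm\in P$ implies $rM\subset P$ or $m\in P$. The (prime) radical $\sqrt{N}$ of a submodule $N$ of $M$ is the intersection of all prime submodules of $M$ that contain $N$; if there is no prime submodule of $M$ containing $N$, then $\sqrt{N}$ is defined to be $M$. (Requiring prime submodules to be proper yields the same $\sqrt{N}$.) $N$ is called a radical submodule if $\sqrt{N}=N$. "Smallest" is with respect to inclusion: $\sqrt{N}$ is a semiprime submodule containing $N$, and it is contained in every semiprime submodule of $M$ containing $N$. *)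

theory Defs
  imports "HOL-Algebra.Module"
begin

(* The counterpart for modules of genideal; meant for S \<subseteq> carrier M. *)
definition gen_submodule ::
    "('a, 'r) ring_scheme \<Rightarrow> ('a, 'b, 'm) module_scheme \<Rightarrow> 'b set \<Rightarrow> 'b set" where
  "gen_submodule R M S = \<Inter>{H. submodule H R M \<and> S \<subseteq> H}"

definition fin_gen_module ::
    "('a, 'r) ring_scheme \<Rightarrow> ('a, 'b, 'm) module_scheme \<Rightarrow> bool" where
  "fin_gen_module R M \<longleftrightarrow>
     (\<exists>S. finite S \<and> S \<subseteq> carrier M \<and> gen_submodule R M S = carrier M)"

(* (N : m) *)
definition colon ::
    "('a, 'r) ring_scheme \<Rightarrow> ('a, 'b, 'm) module_scheme \<Rightarrow> 'b set \<Rightarrow> 'b \<Rightarrow> 'a set" where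
  "colon R M N m = {r \<in> carrier R. r \<odot>\<^bsub>M\<^esub> m \<in> N}"

(* I M *)
definition ideal_smult ::
    "('a, 'r) ring_scheme \<Rightarrow> ('a, 'b, 'm) module_scheme \<Rightarrow> 'a set \<Rightarrow> 'b set" where
  "ideal_smult R M I = gen_submodule R M {a \<odot>\<^bsub>M\<^esub> x | a x. a \<in> I \<and> x \<in> carrier M}"

definition semiprime_submodule ::
    "('a, 'r) ring_scheme \<Rightarrow> ('a, 'b, 'm) module_scheme \<Rightarrow> 'b set \<Rightarrow> bool" where
  "semiprime_submodule R M N \<longleftrightarrow>
     submodule N R M \<and>
     (\<forall>m \<in> carrier M. m \<in> ideal_smult R M (colon R M N m) \<longrightarrow> m \<in> N)"

(* Properness is not required: M is a prime submodule of itself. *)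
definition prime_submodule ::
    "('a, 'r) ring_scheme \<Rightarrow> ('a, 'b, 'm) module_scheme \<Rightarrow> 'b set \<Rightarrow> bool" where
  "prime_submodule R M P \<longleftrightarrow>
     submodule P R M \<and>
     (\<forall>r \<in> carrier R. \<forall>m \<in> carrier M.
        r \<odot>\<^bsub>M\<^esub> m \<in> P \<longrightarrow> (\<forall>x \<in> carrier M. r \<odot>\<^bsub>M\<^esub> x \<in> P) \<or> m \<in> P)"

(* As prime submodules need not be proper here, the else branch never applies when M is a
   module and N \<subseteq> carrier M; it is the usual convention for proper prime submodules. *)
definition submodule_radical ::
    "('a, 'r) ring_scheme \<Rightarrow> ('a, 'b, 'm) module_scheme \<Rightarrow> 'b set \<Rightarrow> 'b set" where
  "submodule_radical R M N =
     (if \<exists>P. prime_submodule R M P \<and> N \<subseteq> P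
      then \<Inter>{P. prime_submodule R M P \<and> N \<subseteq> P}
      else carrier M)"

definition radical_submodule ::
    "('a, 'r) ring_scheme \<Rightarrow> ('a, 'b, 'm) module_scheme \<Rightarrow> 'b set \<Rightarrow> bool" where
  "radical_submodule R M N \<longleftrightarrow> submodule N R M \<and> submodule_radical R M N = N"

end

theory Submission
  imports Defs
begin

text \<open>
  Prime submodules are semiprime, and semiprime submodules are closed under intersection, so the
  radical is semiprime. The content of the theorem is the converse: a semiprime submodule \<open>N\<close> is an
  intersection of prime submodules, that is, every \<open>m \<notin> N\<close> is avoided by some prime \<open>P \<supseteq> N\<close>
  (lemma \<open>semiprime_separation\<close>).

  Choose, by Zorn's lemma, a multiplicative set \<open>S\<close> that is maximal among those disjoint from
  \<open>(N : m)\<close>. Its complement \<open>A\<close> is a minimal prime over \<open>(N : m)\<close>, and the candidate for \<open>P\<close> is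
  the preimage in \<open>M\<close> of the submodule \<open>N + AM\<close> localized at \<open>S\<close>, that is
  \<open>P = {x. \<exists>s \<in> S. s x \<in> N + AM}\<close>. It is prime because each scalar lies in \<open>A\<close>, and then
  sends \<open>M\<close> into \<open>P\<close>, or in \<open>S\<close>, and then can be cancelled.

  Suppose that \<open>m \<in> P\<close>, so that \<open>s m \<in> N + FM\<close> for some \<open>s \<in> S\<close> and a finite \<open>F \<subseteq> A\<close>.
  By maximality of \<open>S\<close>, some power of each \<open>a \<in> F\<close> brings some \<open>S\<close>-multiple of \<open>m\<close> into \<open>N\<close>.
  Multiplying \<open>m\<close>, for one element of \<open>F\<close> after the other, by the largest power that does not yet
  do so gives, after a further multiplication by elements of \<open>S\<close>, a multiple \<open>z\<close> of \<open>s m\<close> with \<open>z \<notin> N\<close> but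
  \<open>F \<subseteq> (N : z)\<close> (lemma \<open>common_annihilating_multiple\<close>). Since \<open>z \<in> N + FM \<subseteq> N + (N : z)M\<close>,
  semiprimeness forces \<open>z \<in> N\<close>, a contradiction.
\<close>

section \<open>Generated submodules and sums\<close>

context module
begin

lemma submodule_zero_closed: "submodule H R M \<Longrightarrow> \<zero>\<^bsub>M\<^esub> \<in> H"
  using subgroup.one_closed[OF submodule.axioms(1)] by fastforce

lemma submodule_Inter:
  assumes "\<H> \<noteq> {}" and "\<And>H. H \<in> \<H> \<Longrightarrow> submodule H R M"
  shows "submodule (\<Inter>\<H>) R M"
proof (rule submoduleI)
  show "\<Inter>\<H> \<subseteq> carrier M"
    using assms submoduleE(1) by blast
  show "\<zero>\<^bsub>M\<^esub> \<in> \<Inter>\<H>"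
    using submodule_zero_closed[OF assms(2)] by blast
  show "\<ominus>\<^bsub>M\<^esub> a \<in> \<Inter>\<H>" if "a \<in> \<Inter>\<H>" for a
    using that assms(2) submoduleE(3) by blast
  show "a \<oplus>\<^bsub>M\<^esub> b \<in> \<Inter>\<H>" if "a \<in> \<Inter>\<H>" "b \<in> \<Inter>\<H>" for a b
    using that assms(2) submoduleE(5) by blast
  show "a \<odot>\<^bsub>M\<^esub> x \<in> \<Inter>\<H>" if "a \<in> carrier R" "x \<in> \<Inter>\<H>" for a x
    using that assms(2) submoduleE(4) by blast
qed

lemma submodule_gen_submodule:
  assumes "S \<subseteq> carrier M"
  shows "submodule (gen_submodule R M S) R M"
  unfolding gen_submodule_def
  using assms carrier_is_submodule by (intro submodule_Inter) auto

lemma gen_submodule_superset: "S \<subseteq> gen_submodule R M S"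
  unfolding gen_submodule_def by blast

lemma smult_in_ideal_smult:
  "a \<in> I \<Longrightarrow> x \<in> carrier M \<Longrightarrow> a \<odot>\<^bsub>M\<^esub> x \<in> ideal_smult R M I"
  unfolding ideal_smult_def by (rule subsetD[OF gen_submodule_superset]) blast

lemma gen_submodule_least:
  "submodule H R M \<Longrightarrow> S \<subseteq> H \<Longrightarrow> gen_submodule R M S \<subseteq> H"
  unfolding gen_submodule_def by blast

end

text \<open>The submodule \<open>N + AM\<close>.\<close>

definition plus_multiples ::
    "('a, 'r) ring_scheme \<Rightarrow> ('a, 'b, 'm) module_scheme \<Rightarrow> 'b set \<Rightarrow> 'a set \<Rightarrow> 'b set" where
  "plus_multiples R M N A =
     gen_submodule R M (N \<union> {a \<odot>\<^bsub>M\<^esub> x | a x. a \<in> A \<and> x \<in> carrier M})"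

context module
begin

lemma submodule_plus_multiples:
  assumes "submodule N R M" and "A \<subseteq> carrier R"
  shows "submodule (plus_multiples R M N A) R M"
  unfolding plus_multiples_def
proof (rule submodule_gen_submodule)
  show "N \<union> {a \<odot>\<^bsub>M\<^esub> x | a x. a \<in> A \<and> x \<in> carrier M} \<subseteq> carrier M"
    using submoduleE(1)[OF assms(1)] assms(2) smult_closed by blast
qed

lemma plus_multiples_superset: "N \<subseteq> plus_multiples R M N A"
  unfolding plus_multiples_def by (rule subset_trans[OF Un_upper1 gen_submodule_superset])

lemma smult_in_plus_multiples:
  "a \<in> A \<Longrightarrow> x \<in> carrier M \<Longrightarrow> a \<odot>\<^bsub>M\<^esub> x \<in> plus_multiples R M N A"
  unfolding plus_multiples_def by (rule subsetD[OF gen_submodule_superset]) blast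

lemma plus_multiples_least:
  assumes "submodule H R M" and "N \<subseteq> H"
    and "\<And>a x. a \<in> A \<Longrightarrow> x \<in> carrier M \<Longrightarrow> a \<odot>\<^bsub>M\<^esub> x \<in> H"
  shows "plus_multiples R M N A \<subseteq> H"
  unfolding plus_multiples_def
  by (rule gen_submodule_least[OF assms(1)]) (use assms(2,3) in blast)

lemma plus_multiples_mono:
  assumes "submodule N R M" and "A \<subseteq> B" and "B \<subseteq> carrier R"
  shows "plus_multiples R M N A \<subseteq> plus_multiples R M N B"
proof (rule plus_multiples_least[OF submodule_plus_multiples[OF assms(1,3)]
      plus_multiples_superset])
  show "a \<odot>\<^bsub>M\<^esub> x \<in> plus_multiples R M N B" if "a \<in> A" "x \<in> carrier M" for a x
    using smult_in_plus_multiples that assms(2) by blast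
qed

text \<open>The union of the submodules \<open>N + FM\<close> over the finite \<open>F \<subseteq> A\<close> is directed, hence itself a
  submodule.\<close>

lemma plus_multiples_finitary:
  assumes N: "submodule N R M" and A: "A \<subseteq> carrier R" and y: "y \<in> plus_multiples R M N A"
  obtains F where "finite F" "F \<subseteq> A" "y \<in> plus_multiples R M N F"
proof -
  define H where "H = (\<Union>F \<in> {F. finite F \<and> F \<subseteq> A}. plus_multiples R M N F)"
  have sub: "submodule (plus_multiples R M N F) R M" if "F \<subseteq> A" for F
    using submodule_plus_multiples[OF N] that A by blast
  have "submodule H R M"
  proof (rule submoduleI)
    show "H \<subseteq> carrier M"
      using submoduleE(1)[OF sub] unfolding H_def by blast
    show "\<zero>\<^bsub>M\<^esub> \<in> H"
      using submodule_zero_closed[OF sub[of "{}"]] unfolding H_def by blast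
    show "\<ominus>\<^bsub>M\<^esub> a \<in> H" if "a \<in> H" for a
      using that submoduleE(3)[OF sub] unfolding H_def by blast
    show "r \<odot>\<^bsub>M\<^esub> x \<in> H" if "r \<in> carrier R" "x \<in> H" for r x
      using that submoduleE(4)[OF sub] unfolding H_def by blast
    fix a b assume "a \<in> H" "b \<in> H"
    then obtain F G where F: "finite F" "F \<subseteq> A" "a \<in> plus_multiples R M N F"
      and G: "finite G" "G \<subseteq> A" "b \<in> plus_multiples R M N G"
      unfolding H_def by blast
    have "a \<in> plus_multiples R M N (F \<union> G)" "b \<in> plus_multiples R M N (F \<union> G)"
      using F G A plus_multiples_mono[OF N, of _ "F \<union> G"] by blast+
    then have "a \<oplus>\<^bsub>M\<^esub> b \<in> plus_multiples R M N (F \<union> G)"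
      using submoduleE(5)[OF sub] F G by blast
    then show "a \<oplus>\<^bsub>M\<^esub> b \<in> H"
      using F G unfolding H_def by blast
  qed
  moreover have "N \<subseteq> H"
    using plus_multiples_superset unfolding H_def by blast
  moreover have "a \<odot>\<^bsub>M\<^esub> x \<in> H" if "a \<in> A" "x \<in> carrier M" for a x
    using smult_in_plus_multiples[of a "{a}"] that unfolding H_def by blast
  ultimately have "plus_multiples R M N A \<subseteq> H"
    by (rule plus_multiples_least)
  with y that show thesis
    unfolding H_def by blast
qed

lemma plus_multiples_decompose:
  assumes N: "submodule N R M" and I: "I \<subseteq> carrier R" and z: "z \<in> plus_multiples R M N I"
  obtains n x where "n \<in> N" "x \<in> ideal_smult R M I" "z = n \<oplus>\<^bsub>M\<^esub> x"
proof -
  define K where "K = ideal_smult R M I"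
  have K: "submodule K R M"
    unfolding K_def ideal_smult_def using I by (intro submodule_gen_submodule) auto
  note NE = submoduleE[OF N] submodule_zero_closed[OF N]
  note KE = submoduleE[OF K] submodule_zero_closed[OF K]
  define H where "H = {n \<oplus>\<^bsub>M\<^esub> x | n x. n \<in> N \<and> x \<in> K}"
  have HI: "n \<oplus>\<^bsub>M\<^esub> x \<in> H" if "n \<in> N" "x \<in> K" for n x
    using that unfolding H_def by blast
  have "submodule H R M"
  proof (rule submoduleI)
    show "H \<subseteq> carrier M"
      using NE(1) KE(1) M.a_closed unfolding H_def by blast
    show "\<zero>\<^bsub>M\<^esub> \<in> H"
      using HI[OF NE(7) KE(7)] M.l_zero[OF M.zero_closed] by metis
    show "\<ominus>\<^bsub>M\<^esub> a \<in> H" if a: "a \<in> H" for a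
    proof -
      obtain n x where nx: "n \<in> N" "x \<in> K" "a = n \<oplus>\<^bsub>M\<^esub> x"
        using a unfolding H_def by blast
      then have "n \<in> carrier M" "x \<in> carrier M"
        using NE(1) KE(1) by blast+
      then have "\<ominus>\<^bsub>M\<^esub> a = \<ominus>\<^bsub>M\<^esub> n \<oplus>\<^bsub>M\<^esub> \<ominus>\<^bsub>M\<^esub> x"
        by (simp add: nx(3) M.minus_add)
      with HI[OF NE(3)[OF nx(1)] KE(3)[OF nx(2)]] show ?thesis
        by metis
    qed
    show "r \<odot>\<^bsub>M\<^esub> a \<in> H" if r: "r \<in> carrier R" and a: "a \<in> H" for r a
    proof -
      obtain n x where nx: "n \<in> N" "x \<in> K" "a = n \<oplus>\<^bsub>M\<^esub> x"
        using a unfolding H_def by blast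
      then have "n \<in> carrier M" "x \<in> carrier M"
        using NE(1) KE(1) by blast+
      then have "r \<odot>\<^bsub>M\<^esub> a = r \<odot>\<^bsub>M\<^esub> n \<oplus>\<^bsub>M\<^esub> r \<odot>\<^bsub>M\<^esub> x"
        using r by (simp add: nx(3) smult_r_distr)
      with HI[OF NE(4)[OF r nx(1)] KE(4)[OF r nx(2)]] show ?thesis
        by metis
    qed
    show "a \<oplus>\<^bsub>M\<^esub> b \<in> H" if a: "a \<in> H" and b: "b \<in> H" for a b
    proof -
      obtain n x where nx: "n \<in> N" "x \<in> K" "a = n \<oplus>\<^bsub>M\<^esub> x"
        using a unfolding H_def by blast
      obtain n' x' where nx': "n' \<in> N" "x' \<in> K" "b = n' \<oplus>\<^bsub>M\<^esub> x'"
        using b unfolding H_def by blast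
      have "n \<in> carrier M" "n' \<in> carrier M" "x \<in> carrier M" "x' \<in> carrier M"
        using nx nx' NE(1) KE(1) by blast+
      then have "a \<oplus>\<^bsub>M\<^esub> b = (n \<oplus>\<^bsub>M\<^esub> n') \<oplus>\<^bsub>M\<^esub> (x \<oplus>\<^bsub>M\<^esub> x')"
        by (simp add: nx(3) nx'(3) M.a_ac)
      with HI[OF NE(5)[OF nx(1) nx'(1)] KE(5)[OF nx(2) nx'(2)]] show ?thesis
        by metis
    qed
  qed
  moreover have "N \<subseteq> H"
  proof
    fix n assume n: "n \<in> N"
    then have "n \<oplus>\<^bsub>M\<^esub> \<zero>\<^bsub>M\<^esub> = n"
      using NE(1) M.r_zero by blast
    with HI[OF n KE(7)] show "n \<in> H"
      by metis
  qed
  moreover have "a \<odot>\<^bsub>M\<^esub> x \<in> H" if "a \<in> I" "x \<in> carrier M" for a x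
  proof -
    have "a \<odot>\<^bsub>M\<^esub> x \<in> K"
      unfolding K_def using that by (rule smult_in_ideal_smult)
    then have "\<zero>\<^bsub>M\<^esub> \<oplus>\<^bsub>M\<^esub> a \<odot>\<^bsub>M\<^esub> x = a \<odot>\<^bsub>M\<^esub> x"
      using KE(1) M.l_zero by blast
    with HI[OF NE(7) \<open>a \<odot>\<^bsub>M\<^esub> x \<in> K\<close>] show ?thesis
      by metis
  qed
  ultimately have "plus_multiples R M N I \<subseteq> H"
    by (rule plus_multiples_least)
  with z obtain n x where "n \<in> N" "x \<in> K" "z = n \<oplus>\<^bsub>M\<^esub> x"
    unfolding H_def by blast
  then show thesis
    unfolding K_def by (rule that)
qed

section \<open>Semiprime submodules\<close>

lemma colon_add:
  assumes N: "submodule N R M" and n: "n \<in> N" and x: "x \<in> carrier M"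
  shows "colon R M N (n \<oplus>\<^bsub>M\<^esub> x) = colon R M N x"
proof -
  have nM: "n \<in> carrier M"
    using submoduleE(1)[OF N] n by blast
  have "r \<odot>\<^bsub>M\<^esub> (n \<oplus>\<^bsub>M\<^esub> x) \<in> N \<longleftrightarrow> r \<odot>\<^bsub>M\<^esub> x \<in> N" if r: "r \<in> carrier R" for r
  proof
    have rn: "r \<odot>\<^bsub>M\<^esub> n \<in> N"
      using submoduleE(4)[OF N] r n by blast
    have eq: "r \<odot>\<^bsub>M\<^esub> (n \<oplus>\<^bsub>M\<^esub> x) = r \<odot>\<^bsub>M\<^esub> n \<oplus>\<^bsub>M\<^esub> r \<odot>\<^bsub>M\<^esub> x"
      using r nM x by (simp add: smult_r_distr)
    show "r \<odot>\<^bsub>M\<^esub> (n \<oplus>\<^bsub>M\<^esub> x) \<in> N" if "r \<odot>\<^bsub>M\<^esub> x \<in> N"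
      using eq submoduleE(5)[OF N] rn that by simp
    assume "r \<odot>\<^bsub>M\<^esub> (n \<oplus>\<^bsub>M\<^esub> x) \<in> N"
    then have "\<ominus>\<^bsub>M\<^esub> (r \<odot>\<^bsub>M\<^esub> n) \<oplus>\<^bsub>M\<^esub> (r \<odot>\<^bsub>M\<^esub> n \<oplus>\<^bsub>M\<^esub> r \<odot>\<^bsub>M\<^esub> x) \<in> N"
      using eq submoduleE(5)[OF N] submoduleE(3)[OF N] rn by simp
    then show "r \<odot>\<^bsub>M\<^esub> x \<in> N"
      using r nM x by (simp add: M.r_neg1)
  qed
  then show ?thesis
    unfolding colon_def by blast
qed

text \<open>Semiprimeness of \<open>N\<close> is a property of the quotient module: the defining condition may be
  checked modulo \<open>N\<close>, since \<open>(N : z)\<close> depends only on the class of \<open>z\<close>.\<close>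

lemma semiprime_mod:
  assumes N: "semiprime_submodule R M N"
    and z: "z \<in> plus_multiples R M N (colon R M N z)"
  shows "z \<in> N"
proof -
  have sub: "submodule N R M"
    using N unfolding semiprime_submodule_def by blast
  have I: "colon R M N z \<subseteq> carrier R"
    unfolding colon_def by blast
  obtain n x where n: "n \<in> N" and x: "x \<in> ideal_smult R M (colon R M N z)"
    and zeq: "z = n \<oplus>\<^bsub>M\<^esub> x"
    using plus_multiples_decompose[OF sub I z] by blast
  have "submodule (ideal_smult R M (colon R M N z)) R M"
    unfolding ideal_smult_def using I by (intro submodule_gen_submodule) auto
  then have xM: "x \<in> carrier M"
    using submoduleE(1) x by blast
  have "x \<in> ideal_smult R M (colon R M N x)"
    using x colon_add[OF sub n xM] zeq by simp
  then have "x \<in> N"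
    using N xM unfolding semiprime_submodule_def by blast
  then show ?thesis
    using submoduleE(5)[OF sub n] zeq by simp
qed

text \<open>If \<open>m \<notin> P\<close>, then every scalar that sends \<open>m\<close> into the prime submodule \<open>P\<close> sends all of \<open>M\<close>
  into \<open>P\<close>; so \<open>(P : m)M \<subseteq> P\<close> does not contain \<open>m\<close>.\<close>

lemma prime_imp_semiprime:
  assumes P: "prime_submodule R M P"
  shows "semiprime_submodule R M P"
  unfolding semiprime_submodule_def
proof (intro conjI ballI impI)
  show sub: "submodule P R M"
    using P unfolding prime_submodule_def by blast
  fix m assume m: "m \<in> carrier M" and mI: "m \<in> ideal_smult R M (colon R M P m)"
  show "m \<in> P"
  proof (rule ccontr)
    assume "m \<notin> P"
    then have "a \<odot>\<^bsub>M\<^esub> x \<in> P" if "a \<in> colon R M P m" "x \<in> carrier M" for a x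
      using P m that unfolding prime_submodule_def colon_def by blast
    then have "ideal_smult R M (colon R M P m) \<subseteq> P"
      unfolding ideal_smult_def by (intro gen_submodule_least[OF sub]) blast
    with mI \<open>m \<notin> P\<close> show False by blast
  qed
qed

lemma semiprime_Inter:
  assumes ne: "\<H> \<noteq> {}" and semi: "\<And>H. H \<in> \<H> \<Longrightarrow> semiprime_submodule R M H"
  shows "semiprime_submodule R M (\<Inter>\<H>)"
  unfolding semiprime_submodule_def
proof (intro conjI ballI impI InterI)
  show "submodule (\<Inter>\<H>) R M"
    using ne semi unfolding semiprime_submodule_def by (intro submodule_Inter) auto
  fix m H
  assume m: "m \<in> carrier M" and mI: "m \<in> ideal_smult R M (colon R M (\<Inter>\<H>) m)" and H: "H \<in> \<H>"
  let ?K = "ideal_smult R M (colon R M H m)"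
  have gens: "a \<odot>\<^bsub>M\<^esub> x \<in> ?K" if "a \<in> colon R M (\<Inter>\<H>) m" "x \<in> carrier M" for a x
    by (rule smult_in_ideal_smult) (use that H in \<open>auto simp: colon_def\<close>)
  have "submodule ?K R M"
    unfolding ideal_smult_def by (rule submodule_gen_submodule) (auto simp: colon_def)
  then have "ideal_smult R M (colon R M (\<Inter>\<H>) m) \<subseteq> ?K"
    unfolding ideal_smult_def[of R M "colon R M (\<Inter>\<H>) m"]
    by (rule gen_submodule_least) (use gens in blast)
  with mI have "m \<in> ?K"
    by (rule rev_subsetD)
  with m semi[OF H] show "m \<in> H"
    unfolding semiprime_submodule_def by simp
qed

section \<open>Prime submodules from multiplicative sets\<close>

text \<open>The preimage in \<open>M\<close> of the localization at \<open>S\<close> of \<open>N + AM\<close>, where \<open>A\<close> is the complement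
  of \<open>S\<close>. When \<open>A\<close> is a prime ideal, this is the kernel of the map from \<open>M\<close> to the fibre of
  \<open>M/N\<close> at \<open>A\<close>.\<close>

definition saturation :: "'a set \<Rightarrow> 'c set \<Rightarrow> 'c set" where
  "saturation S N =
     {x \<in> carrier M. \<exists>s \<in> S. s \<odot>\<^bsub>M\<^esub> x \<in> plus_multiples R M N (carrier R - S)}"

lemma saturation_superset:
  assumes "submodule N R M" and "submonoid S R"
  shows "N \<subseteq> saturation S N"
proof
  fix x assume x: "x \<in> N"
  then have "x \<in> carrier M"
    using submoduleE(1)[OF assms(1)] by blast
  moreover from this have "\<one> \<odot>\<^bsub>M\<^esub> x \<in> plus_multiples R M N (carrier R - S)"
    using x plus_multiples_superset by auto
  ultimately show "x \<in> saturation S N"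
    using submonoid.one_closed[OF assms(2)] unfolding saturation_def by blast
qed

text \<open>A scalar outside \<open>S\<close> sends \<open>M\<close> into \<open>N + AM\<close> by construction, and a scalar in \<open>S\<close> can be
  absorbed into the denominator, so it can be cancelled.\<close>

lemma prime_saturation:
  assumes N: "submodule N R M" and S: "submonoid S R"
  shows "prime_submodule R M (saturation S N)"
  unfolding prime_submodule_def
proof (intro conjI ballI impI)
  define K where "K = plus_multiples R M N (carrier R - S)"
  have K: "submodule K R M"
    unfolding K_def by (rule submodule_plus_multiples[OF N]) blast
  note SR = submonoid.subset[OF S] and mult = submonoid.m_closed[OF S]
    and one = submonoid.one_closed[OF S]
  have satI: "x \<in> saturation S N" if "x \<in> carrier M" "s \<in> S" "s \<odot>\<^bsub>M\<^esub> x \<in> K" for s x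
    using that unfolding saturation_def K_def by blast
  have satE: "\<exists>s \<in> S. s \<odot>\<^bsub>M\<^esub> x \<in> K" and satM: "x \<in> carrier M" if "x \<in> saturation S N" for x
    using that unfolding saturation_def K_def by blast+
  show "submodule (saturation S N) R M"
  proof (rule submoduleI)
    show "saturation S N \<subseteq> carrier M"
      using satM by blast
    show "\<zero>\<^bsub>M\<^esub> \<in> saturation S N"
      using satI[OF _ one] submodule_zero_closed[OF K] by simp
    show "\<ominus>\<^bsub>M\<^esub> x \<in> saturation S N" if x: "x \<in> saturation S N" for x
    proof -
      obtain s where s: "s \<in> S" "s \<odot>\<^bsub>M\<^esub> x \<in> K"
        using satE[OF x] by blast
      have "s \<odot>\<^bsub>M\<^esub> (\<ominus>\<^bsub>M\<^esub> x) = \<ominus>\<^bsub>M\<^esub> (s \<odot>\<^bsub>M\<^esub> x)"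
        using SR s(1) satM[OF x] by (intro smult_r_minus) blast+
      then show ?thesis
        using satI[OF _ s(1)] submoduleE(3)[OF K s(2)] satM[OF x] by simp
    qed
    show "r \<odot>\<^bsub>M\<^esub> x \<in> saturation S N" if r: "r \<in> carrier R" and x: "x \<in> saturation S N" for r x
    proof -
      obtain s where s: "s \<in> S" "s \<odot>\<^bsub>M\<^esub> x \<in> K"
        using satE[OF x] by blast
      have sR: "s \<in> carrier R" using s SR by blast
      have "s \<odot>\<^bsub>M\<^esub> (r \<odot>\<^bsub>M\<^esub> x) = r \<odot>\<^bsub>M\<^esub> (s \<odot>\<^bsub>M\<^esub> x)"
        using sR r satM[OF x] by (simp add: smult_assoc1[symmetric] R.m_comm)
      then show ?thesis
        using satI[OF _ s(1)] submoduleE(4)[OF K r s(2)] satM[OF x] r by simp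
    qed
    show "x \<oplus>\<^bsub>M\<^esub> y \<in> saturation S N" if x: "x \<in> saturation S N" and y: "y \<in> saturation S N" for x y
    proof -
      obtain s where s: "s \<in> S" "s \<odot>\<^bsub>M\<^esub> x \<in> K"
        using satE[OF x] by blast
      obtain t where t: "t \<in> S" "t \<odot>\<^bsub>M\<^esub> y \<in> K"
        using satE[OF y] by blast
      have R: "s \<in> carrier R" "t \<in> carrier R" using s t SR by blast+
      have "(s \<otimes> t) \<odot>\<^bsub>M\<^esub> (x \<oplus>\<^bsub>M\<^esub> y) = t \<odot>\<^bsub>M\<^esub> (s \<odot>\<^bsub>M\<^esub> x) \<oplus>\<^bsub>M\<^esub> s \<odot>\<^bsub>M\<^esub> (t \<odot>\<^bsub>M\<^esub> y)"
        using R satM[OF x] satM[OF y]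
        by (simp add: smult_r_distr smult_assoc1[symmetric] R.m_comm)
      then have "(s \<otimes> t) \<odot>\<^bsub>M\<^esub> (x \<oplus>\<^bsub>M\<^esub> y) \<in> K"
        using submoduleE(5)[OF K submoduleE(4)[OF K R(2) s(2)] submoduleE(4)[OF K R(1) t(2)]]
        by simp
      then show ?thesis
        using satI[OF _ mult[OF s(1) t(1)]] satM[OF x] satM[OF y] M.a_closed by blast
    qed
  qed
  fix r m
  assume r: "r \<in> carrier R" and m: "m \<in> carrier M" and rm: "r \<odot>\<^bsub>M\<^esub> m \<in> saturation S N"
  show "(\<forall>x \<in> carrier M. r \<odot>\<^bsub>M\<^esub> x \<in> saturation S N) \<or> m \<in> saturation S N"
  proof (cases "r \<in> S")
    case True
    obtain s where s: "s \<in> S" "s \<odot>\<^bsub>M\<^esub> (r \<odot>\<^bsub>M\<^esub> m) \<in> K"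
      using satE[OF rm] by blast
    then have "(s \<otimes> r) \<odot>\<^bsub>M\<^esub> m \<in> K"
      using SR r m by (simp add: smult_assoc1 subset_iff)
    then show ?thesis
      using satI[OF m mult[OF s(1) True]] by blast
  next
    case False
    then have "r \<odot>\<^bsub>M\<^esub> x \<in> K" if "x \<in> carrier M" for x
      using smult_in_plus_multiples[of r "carrier R - S"] r that unfolding K_def by blast
    then show ?thesis
      using satI[OF _ one] r by simp
  qed
qed

section \<open>Separation of a point from a semiprime submodule\<close>

text \<open>A multiplicative set disjoint from the ideal \<open>(N : m)\<close> and maximal as such has a minimal
  prime over \<open>(N : m)\<close> as its complement: localizing there makes each element of the complement
  nilpotent modulo \<open>(N : m)\<close>, which is what the last clause says.\<close>

lemma maximal_multiplicative_set:
  assumes N: "submodule N R M" and m: "m \<in> carrier M" "m \<notin> N"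
  obtains S where "submonoid S R" "\<And>s. s \<in> S \<Longrightarrow> s \<odot>\<^bsub>M\<^esub> m \<notin> N"
    "\<And>a. a \<in> carrier R - S \<Longrightarrow> \<exists>u \<in> S. \<exists>n::nat. (u \<otimes> a [^] n) \<odot>\<^bsub>M\<^esub> m \<in> N"
proof -
  define \<S> where "\<S> = {S. submonoid S R \<and> (\<forall>s \<in> S. s \<odot>\<^bsub>M\<^esub> m \<notin> N)}"
  have "\<exists>S\<in>\<S>. \<forall>T\<in>\<S>. S \<subseteq> T \<longrightarrow> T = S"
  proof (rule subset_Zorn_nonempty)
    have "submonoid {\<one>} R"
      by (simp add: submonoid_def)
    then have "{\<one>} \<in> \<S>"
      using m unfolding \<S>_def by simp
    then show "\<S> \<noteq> {}"
      by blast
    fix \<C> assume ne: "\<C> \<noteq> {}" and "subset.chain \<S> \<C>"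
    then have sub: "\<C> \<subseteq> \<S>" and chain: "\<And>X Y. X \<in> \<C> \<Longrightarrow> Y \<in> \<C> \<Longrightarrow> X \<subseteq> Y \<or> Y \<subseteq> X"
      by (auto simp: subset_chain_def)
    have mon: "submonoid X R" if "X \<in> \<C>" for X
      using that sub unfolding \<S>_def by blast
    have "submonoid (\<Union>\<C>) R"
    proof
      show "\<Union>\<C> \<subseteq> carrier R"
        by (rule Union_least) (rule submonoid.subset[OF mon])
      obtain X where "X \<in> \<C>"
        using ne by blast
      with submonoid.one_closed[OF mon[OF this]] show "\<one> \<in> \<Union>\<C>"
        by (rule UnionI[rotated])
      fix x y assume "x \<in> \<Union>\<C>" "y \<in> \<Union>\<C>"
      then obtain X where X: "X \<in> \<C>" "x \<in> X" "y \<in> X"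
        using chain by (meson UnionE subsetD)
      then show "x \<otimes> y \<in> \<Union>\<C>"
        using submonoid.m_closed[OF mon[OF X(1)] X(2,3)] by blast
    qed
    moreover have "\<forall>s \<in> \<Union>\<C>. s \<odot>\<^bsub>M\<^esub> m \<notin> N"
      using sub unfolding \<S>_def by blast
    ultimately show "\<Union>\<C> \<in> \<S>"
      unfolding \<S>_def by simp
  qed
  then obtain S where "S \<in> \<S>" and max: "\<And>T. T \<in> \<S> \<Longrightarrow> S \<subseteq> T \<Longrightarrow> T = S"
    by blast
  then have S: "submonoid S R" and disj: "\<And>s. s \<in> S \<Longrightarrow> s \<odot>\<^bsub>M\<^esub> m \<notin> N"
    by (simp_all add: \<S>_def)
  note SR = submonoid.subset[OF S] and one = submonoid.one_closed[OF S]
  have "\<exists>u \<in> S. \<exists>n::nat. (u \<otimes> a [^] n) \<odot>\<^bsub>M\<^esub> m \<in> N" if a: "a \<in> carrier R - S" for a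
  proof (rule ccontr)
    assume no: "\<not> ?thesis"
    \<comment> \<open>The multiplicative set generated by \<open>S\<close> and \<open>a\<close>; it would also be disjoint from
      \<open>(N : m)\<close>, which contradicts maximality.\<close>
    define T where "T = {u \<otimes> a [^] n | u n. u \<in> S \<and> n \<in> (UNIV :: nat set)}"
    have TI: "u \<otimes> a [^] n \<in> T" if "u \<in> S" for u and n :: nat
      using that unfolding T_def by blast
    have aR: "a \<in> carrier R" using a by blast
    have "S \<subseteq> T"
    proof
      fix u assume u: "u \<in> S"
      then have "u \<otimes> a [^] (0 :: nat) = u"
        using subsetD[OF SR u] by simp
      with TI[OF u, of 0] show "u \<in> T"
        by metis
    qed
    have "submonoid T R"
    proof
      show "T \<subseteq> carrier R"
      proof
        fix x assume "x \<in> T"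
        then obtain u and n :: nat where "u \<in> S" "x = u \<otimes> a [^] n"
          unfolding T_def by blast
        then show "x \<in> carrier R"
          using subsetD[OF SR, of u] aR by simp
      qed
      show "\<one> \<in> T"
        using \<open>S \<subseteq> T\<close> one by blast
      fix x y assume "x \<in> T" "y \<in> T"
      then obtain u v and k l :: nat
        where u: "u \<in> S" "x = u \<otimes> a [^] k" and v: "v \<in> S" "y = v \<otimes> a [^] l"
        unfolding T_def by blast
      have uv: "u \<in> carrier R" "v \<in> carrier R" using u v SR by blast+
      have "x \<otimes> y = (u \<otimes> v) \<otimes> (a [^] k \<otimes> a [^] l)"
        using u v uv aR by (simp add: R.m_ac)
      also have "\<dots> = (u \<otimes> v) \<otimes> a [^] (k + l)"
        using aR by (simp add: R.nat_pow_mult)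
      finally show "x \<otimes> y \<in> T"
        using TI submonoid.m_closed[OF S u(1) v(1)] by simp
    qed
    moreover have "\<forall>s \<in> T. s \<odot>\<^bsub>M\<^esub> m \<notin> N"
      using no unfolding T_def by blast
    ultimately have "T \<in> \<S>"
      unfolding \<S>_def by simp
    then have "T = S"
      using max \<open>S \<subseteq> T\<close> by simp
    moreover have "a \<in> T"
      using TI[OF one, of 1] aR by simp
    ultimately show False
      using a by blast
  qed
  then show thesis
    using that[OF S disj] by simp
qed

text \<open>The factor \<open>r\<close> is a product of powers of the elements of \<open>F\<close>: each new element \<open>a\<close> contributes
  the largest power for which no \<open>S\<close>-multiple is sent into \<open>N\<close>, so that one further factor \<open>a\<close>
  together with some \<open>t \<in> S\<close> suffices.\<close>

lemma common_annihilating_multiple: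
  assumes N: "submodule N R M" and m: "m \<in> carrier M" and S: "submonoid S R"
    and disj: "\<And>s. s \<in> S \<Longrightarrow> s \<odot>\<^bsub>M\<^esub> m \<notin> N"
    and nilp: "\<And>a. a \<in> carrier R - S \<Longrightarrow> \<exists>u \<in> S. \<exists>n::nat. (u \<otimes> a [^] n) \<odot>\<^bsub>M\<^esub> m \<in> N"
    and F: "finite F" "F \<subseteq> carrier R - S"
  shows "\<exists>r \<in> carrier R. (\<forall>s \<in> S. (s \<otimes> r) \<odot>\<^bsub>M\<^esub> m \<notin> N) \<and>
           (\<exists>t \<in> S. \<forall>a \<in> F. (a \<otimes> (t \<otimes> r)) \<odot>\<^bsub>M\<^esub> m \<in> N)"
  using F
proof (induction F rule: finite_induct)
  case empty
  have "(s \<otimes> \<one>) \<odot>\<^bsub>M\<^esub> m \<notin> N" if "s \<in> S" for s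
    using disj[OF that] submonoid.subset[OF S] that by (simp add: subset_iff)
  then show ?case
    using submonoid.one_closed[OF S] by blast
next
  case (insert a F)
  have SR: "s \<in> carrier R" if "s \<in> S" for s
    using that submonoid.subset[OF S] by blast
  have scale: "(b \<otimes> c) \<odot>\<^bsub>M\<^esub> m \<in> N" if "b \<in> carrier R" "c \<in> carrier R" "c \<odot>\<^bsub>M\<^esub> m \<in> N" for b c
    using that m submoduleE(4)[OF N] by (simp add: smult_assoc1)
  obtain r t where r: "r \<in> carrier R" and avoid: "\<And>s. s \<in> S \<Longrightarrow> (s \<otimes> r) \<odot>\<^bsub>M\<^esub> m \<notin> N"
    and t: "t \<in> S" and kill: "\<And>b. b \<in> F \<Longrightarrow> (b \<otimes> (t \<otimes> r)) \<odot>\<^bsub>M\<^esub> m \<in> N"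
    using insert by blast
  have aS: "a \<in> carrier R - S" and aR: "a \<in> carrier R" and FR: "F \<subseteq> carrier R"
    using insert.prems by blast+
  \<comment> \<open>Some \<open>S\<close>-multiple of \<open>a\<^sup>n r m\<close> lies in \<open>N\<close>. The least such \<open>n\<close> is positive, and its
    predecessor \<open>k\<close> is the exponent of \<open>a\<close> in the new factor.\<close>
  define Q where "Q n \<longleftrightarrow> (\<exists>u \<in> S. (u \<otimes> (a [^] n \<otimes> r)) \<odot>\<^bsub>M\<^esub> m \<in> N)" for n :: nat
  have "\<exists>n. Q n"
  proof -
    obtain u and n :: nat where u: "u \<in> S" "(u \<otimes> a [^] n) \<odot>\<^bsub>M\<^esub> m \<in> N"
      using nilp[OF aS] by blast
    have "u \<otimes> (a [^] n \<otimes> r) = r \<otimes> (u \<otimes> a [^] n)"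
      using SR[OF u(1)] aR r by (simp add: R.m_ac)
    moreover have "(r \<otimes> (u \<otimes> a [^] n)) \<odot>\<^bsub>M\<^esub> m \<in> N"
      using scale[OF r _ u(2)] SR[OF u(1)] aR by simp
    ultimately have "(u \<otimes> (a [^] n \<otimes> r)) \<odot>\<^bsub>M\<^esub> m \<in> N"
      by metis
    then show ?thesis
      using u(1) unfolding Q_def by blast
  qed
  then obtain n where n: "Q n" and least: "\<And>k. k < n \<Longrightarrow> \<not> Q k"
    using exists_least_iff[of Q] by blast
  have "\<not> Q 0"
    using avoid r unfolding Q_def by simp
  then obtain k where k: "n = Suc k"
    using n by (cases n) auto
  define r' where "r' = a [^] k \<otimes> r"
  have r': "r' \<in> carrier R"
    using aR r unfolding r'_def by simp
  have avoid': "(s \<otimes> r') \<odot>\<^bsub>M\<^esub> m \<notin> N" if "s \<in> S" for s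
    using least[of k] k that unfolding Q_def r'_def by blast
  obtain u where u: "u \<in> S" "(u \<otimes> (a [^] n \<otimes> r)) \<odot>\<^bsub>M\<^esub> m \<in> N"
    using n unfolding Q_def by blast
  have R: "u \<in> carrier R" "t \<in> carrier R"
    using SR u t by blast+
  have "(a \<otimes> ((u \<otimes> t) \<otimes> r')) \<odot>\<^bsub>M\<^esub> m \<in> N"
  proof -
    have "a \<otimes> ((u \<otimes> t) \<otimes> r') = t \<otimes> (u \<otimes> (a [^] n \<otimes> r))"
      using R aR r unfolding r'_def k by (simp add: R.m_ac)
    then show ?thesis
      using scale[OF R(2) _ u(2)] R aR r by simp
  qed
  moreover have "(b \<otimes> ((u \<otimes> t) \<otimes> r')) \<odot>\<^bsub>M\<^esub> m \<in> N" if b: "b \<in> F" for b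
  proof -
    have bR: "b \<in> carrier R" using b FR by blast
    have "b \<otimes> ((u \<otimes> t) \<otimes> r') = (u \<otimes> a [^] k) \<otimes> (b \<otimes> (t \<otimes> r))"
      using R aR r bR unfolding r'_def by (simp add: R.m_ac)
    then show ?thesis
      using scale[OF _ _ kill[OF b], of "u \<otimes> a [^] k"] R aR r bR by simp
  qed
  ultimately show ?case
    using r' avoid' submonoid.m_closed[OF S u(1) t] by blast
qed

text \<open>The saturation at a maximal multiplicative set is the required prime. If it contained \<open>m\<close>, a
  suitable multiple \<open>z\<close> of \<open>m\<close> outside \<open>N\<close> would lie in \<open>N + (N : z)M\<close>.\<close>

lemma semiprime_separation:
  assumes semi: "semiprime_submodule R M N" and m: "m \<in> carrier M" "m \<notin> N"
  obtains P where "prime_submodule R M P" "N \<subseteq> P" "m \<notin> P"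
proof -
  have N: "submodule N R M"
    using semi unfolding semiprime_submodule_def by blast
  obtain S where S: "submonoid S R" and disj: "\<And>s. s \<in> S \<Longrightarrow> s \<odot>\<^bsub>M\<^esub> m \<notin> N"
    and nilp: "\<And>a. a \<in> carrier R - S \<Longrightarrow> \<exists>u \<in> S. \<exists>n::nat. (u \<otimes> a [^] n) \<odot>\<^bsub>M\<^esub> m \<in> N"
    using maximal_multiplicative_set[OF N m] by metis
  have "m \<notin> saturation S N"
  proof
    assume "m \<in> saturation S N"
    then obtain s where s: "s \<in> S" "s \<odot>\<^bsub>M\<^esub> m \<in> plus_multiples R M N (carrier R - S)"
      unfolding saturation_def by blast
    obtain F where F: "finite F" "F \<subseteq> carrier R - S" "s \<odot>\<^bsub>M\<^esub> m \<in> plus_multiples R M N F"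
      using plus_multiples_finitary[OF N _ s(2)] by blast
    obtain r t where r: "r \<in> carrier R" and avoid: "\<And>s. s \<in> S \<Longrightarrow> (s \<otimes> r) \<odot>\<^bsub>M\<^esub> m \<notin> N"
      and t: "t \<in> S" and kill: "\<And>a. a \<in> F \<Longrightarrow> (a \<otimes> (t \<otimes> r)) \<odot>\<^bsub>M\<^esub> m \<in> N"
      using common_annihilating_multiple[OF N m(1) S disj nilp F(1,2)] by blast
    have R: "s \<in> carrier R" "t \<in> carrier R" and FR: "F \<subseteq> carrier R"
      using submonoid.subset[OF S] s t F by blast+
    \<comment> \<open>As a multiple of \<open>s m\<close>, \<open>z\<close> stays in \<open>N + FM\<close>; the factor \<open>t r\<close> brings \<open>F\<close> into
      \<open>(N : z)\<close>.\<close>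
    define z where "z = (t \<otimes> r) \<odot>\<^bsub>M\<^esub> (s \<odot>\<^bsub>M\<^esub> m)"
    have "z = (s \<otimes> t \<otimes> r) \<odot>\<^bsub>M\<^esub> m"
      unfolding z_def using R r m by (simp add: smult_assoc1[symmetric] R.m_ac)
    then have "z \<notin> N"
      using avoid submonoid.m_closed[OF S s(1) t] by simp
    have "F \<subseteq> colon R M N z"
    proof
      fix a assume a: "a \<in> F"
      then have aR: "a \<in> carrier R" using FR by blast
      have "a \<odot>\<^bsub>M\<^esub> z = s \<odot>\<^bsub>M\<^esub> ((a \<otimes> (t \<otimes> r)) \<odot>\<^bsub>M\<^esub> m)"
        unfolding z_def using R r aR m by (simp add: smult_assoc1[symmetric] R.m_ac)
      then show "a \<in> colon R M N z"
        using submoduleE(4)[OF N R(1) kill[OF a]] aR unfolding colon_def by simp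
    qed
    moreover have "z \<in> plus_multiples R M N F"
      unfolding z_def using submoduleE(4)[OF submodule_plus_multiples[OF N FR]] F(3) R r by simp
    ultimately have "z \<in> plus_multiples R M N (colon R M N z)"
      using plus_multiples_mono[OF N, of F "colon R M N z"] unfolding colon_def by blast
    then have "z \<in> N"
      by (rule semiprime_mod[OF semi])
    with \<open>z \<notin> N\<close> show False by blast
  qed
  with prime_saturation[OF N S] saturation_superset[OF N S] show thesis
    by (rule that)
qed

section \<open>The radical\<close>

lemma submodule_radical_eq_Inter:
  assumes "N \<subseteq> carrier M"
  shows "{P. prime_submodule R M P \<and> N \<subseteq> P} \<noteq> {}"
    and "submodule_radical R M N = \<Inter>{P. prime_submodule R M P \<and> N \<subseteq> P}"
proof -
  have "prime_submodule R M (carrier M)"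
    using carrier_is_submodule unfolding prime_submodule_def by blast
  then show "{P. prime_submodule R M P \<and> N \<subseteq> P} \<noteq> {}"
    using assms by blast
  then show "submodule_radical R M N = \<Inter>{P. prime_submodule R M P \<and> N \<subseteq> P}"
    unfolding submodule_radical_def by auto
qed

lemma semiprime_radical:
  assumes "N \<subseteq> carrier M"
  shows "semiprime_submodule R M (submodule_radical R M N)"
  unfolding submodule_radical_eq_Inter(2)[OF assms]
  using submodule_radical_eq_Inter(1)[OF assms] prime_imp_semiprime
  by (intro semiprime_Inter) auto

lemma radical_superset:
  assumes "N \<subseteq> carrier M"
  shows "N \<subseteq> submodule_radical R M N"
  unfolding submodule_radical_eq_Inter(2)[OF assms] by blast

lemma radical_least_semiprime:
  assumes semi: "semiprime_submodule R M S" and sub: "N \<subseteq> S"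
  shows "submodule_radical R M N \<subseteq> S"
proof
  have "submodule S R M"
    using semi unfolding semiprime_submodule_def by blast
  then have NM: "N \<subseteq> carrier M"
    using submoduleE(1) sub by blast
  fix x assume x: "x \<in> submodule_radical R M N"
  have "x \<in> carrier M"
    using x semiprime_radical[OF NM] submoduleE(1) unfolding semiprime_submodule_def by blast
  show "x \<in> S"
  proof (rule ccontr)
    assume "x \<notin> S"
    then obtain P where "prime_submodule R M P" "S \<subseteq> P" "x \<notin> P"
      using semiprime_separation[OF semi \<open>x \<in> carrier M\<close>] by blast
    with x sub show False
      unfolding submodule_radical_eq_Inter(2)[OF NM] by blast
  qed
qed

end

theorem theorem2p6:
  fixes R :: "('a, 'r) ring_scheme" and M :: "('a, 'b, 'm) module_scheme" and N :: "'b set"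
  assumes "module R M"
    and "fin_gen_module R M"
    and "submodule N R M"
    and "N \<noteq> carrier M"
  shows "(semiprime_submodule R M (submodule_radical R M N)
          \<and> N \<subseteq> submodule_radical R M N
          \<and> (\<forall>S. semiprime_submodule R M S \<and> N \<subseteq> S \<longrightarrow> submodule_radical R M N \<subseteq> S))
       \<and> (semiprime_submodule R M N \<longleftrightarrow> radical_submodule R M N)"
proof -
  interpret module R M by fact
  have NM: "N \<subseteq> carrier M"
    using submoduleE(1)[OF assms(3)] .
  note rad = semiprime_radical[OF NM] radical_superset[OF NM]
  have "submodule_radical R M N = N" if "semiprime_submodule R M N"
    using radical_least_semiprime[OF that, of N] rad(2) by blast
  then have "semiprime_submodule R M N \<longleftrightarrow> radical_submodule R M N"
    using rad(1) assms(3) unfolding radical_submodule_def by auto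
  then show ?thesis
    using rad radical_least_semiprime by blast
qed

end
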